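(* The upper bounds $A(\mathcal{E})\le\log\frac{2d}{d+1}$ and $W(\mathcal{P})\le\log\frac{2d}{d+1}$, valid for $d$-dimensional SIC ensembles $\mathcal{E}$ and SIC POVMs $\mathcal{P}$, are tight in dimension $d=3$: there exist a $3$-dimensional SIC ensemble $\mathcal{E}$ and a $3$-dimensional SIC POVM $\mathcal{P}$ such that $$A(\mathcal{E})=W(\mathcal{P})=\log\frac32 .$$ The accessible information $A(\mathcal{E})$ is achieved by an orthonormal POVM, and the informational power $W(\mathcal{P})$ is achieved by an orthonormal ensemble.
   Context: $\log$ is the base-2 logarithm. A state is a positive semidefinite operator $\rho$ with $\operatorname{Tr}\rho\le 1$. A discrete ensemble is a family $\mathcal{E}=\{\rho_x\}$ of states indexed by a countable set of real numbers with $\sum_x\operatorname{Tr}[\rho_x]=1$; a continuous ensemble is a measurable function $x\mapsto\rho_x$, from a measurable set of real numbers to states, with $\int dx\,\operatorname{Tr}[\rho_x]=1$. Its average state is $\rho=\sum_x\rho_x$ (resp. $\int dx\,\rho_x$). An effect is an operator $\Pi$ with $0\le\Pi\le\mathbb{1}$. A discrete (resp. continuous) POVM is a family $\mathcal{P}=\{\Pi_y\}$ of effects, indexed by a countable (resp. measurably by a measurable) set of real numbers, with $\sum_y\Pi_y=\mathbb{1}$ (resp. $\int dy\,\Pi_y=\mathbb{1}$). Given $\mathcal{E},\mathcal{P}$ on the same space, let $p(x,y)=\operatorname{Tr}[\rho_x\Pi_y]$, with marginals $p(x)=\operatorname{Tr}[\rho_x]$, $p(y)=\operatorname{Tr}[\rho\Pi_y]$;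 the mutual information is $I(\mathcal{E},\mathcal{P})=\sum_{x,y}p(x,y)\log\frac{p(x,y)}{p(x)p(y)}$, sums being replaced by integrals for continuous indices (terms with $p(x,y)=0$ count as $0$). Accessible information: $A(\mathcal{E})=\sup_{\mathcal{P}}I(\mathcal{E},\mathcal{P})$ over all discrete or continuous POVMs. Informational power: $W(\mathcal{P})=\sup_{\mathcal{E}}I(\mathcal{E},\mathcal{P})$ over all discrete or continuous ensembles. "Achieved by" means that the stated POVM (ensemble) attains the supremum. A $d$-dimensional SIC set of operators is a family $\{X_x\}_{x=1}^{d^2}$ of rank-one positive semidefinite operators on a $d$-dimensional complex Hilbert space such that, for some $\lambda$, $\operatorname{Tr}[X_x]=\lambda$ for all $x$ and $\operatorname{Tr}[X_xX_y]=\frac{\lambda^2}{d+1}$ for $x\neq y$. A SIC ensemble is a SIC set with $\lambda=\frac1{d^2}$; a SIC POVM is a SIC set with $\lambda=\frac1d$. An orthonormal POVM is $\{|e_y\rangle\langle e_y|\}_{y=1}^d$, and an orthonormal ensemble is $\{\frac1d|e_x\rangle\langle e_x|\}_{x=1}^d$, for an orthonormal basis $\{|e_x\rangle\}_{x=1}^d$ of the space. *)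

theory Defs
  imports "HOL-Analysis.Analysis"
begin

text \<open>
  The \<open>d\<close>-dimensional space is \<open>complex^'n\<close> with \<open>d = CARD('n)\<close>. The real inner product
  \<open>\<bullet>\<close> of the library is not the Hermitian form, so the latter is defined here
  (antilinear in the first argument).
\<close>

definition hinner :: "complex^'n \<Rightarrow> complex^'n \<Rightarrow> complex" where
  "hinner u v = (\<Sum>i\<in>UNIV. cnj (u $ i) * v $ i)"

definition psd :: "complex^'n^'n \<Rightarrow> bool" where
  "psd A \<longleftrightarrow> (\<forall>v. hinner v (A *v v) \<in> \<real>\<^sub>\<ge>\<^sub>0)"

definition ketbra :: "complex^'n \<Rightarrow> complex^'n^'n" where
  "ketbra e = (\<chi> i j. e $ i * cnj (e $ j))"

definition state :: "complex^'n^'n \<Rightarrow> bool" where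
  "state \<rho> \<longleftrightarrow> psd \<rho> \<and> Re (trace \<rho>) \<le> 1"

definition effect :: "complex^'n^'n \<Rightarrow> bool" where
  "effect A \<longleftrightarrow> psd A \<and> psd (mat 1 - A)"

text \<open>
  A family of operators is a pair of an index measure and a function on the reals; only the
  values on the space of the index measure matter. Discrete families carry the counting
  measure of a countable set and continuous ones the Lebesgue measure on a measurable set,
  so that integrals over the index measure are sums in the first case and ordinary
  integrals in the second.
\<close>

type_synonym 'n opfam = "real measure \<times> (real \<Rightarrow> complex^'n^'n)"

abbreviation index :: "'n::finite opfam \<Rightarrow> real measure" where "index F \<equiv> fst F"
abbreviation oper :: "'n::finite opfam \<Rightarrow> real \<Rightarrow> complex^'n^'n" where "oper F \<equiv> snd F"

definition discrete_index :: "real measure \<Rightarrow> bool" where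
  "discrete_index M \<longleftrightarrow> (\<exists>S. countable S \<and> M = count_space S)"

definition continuous_index :: "real measure \<Rightarrow> bool" where
  "continuous_index M \<longleftrightarrow> (\<exists>S\<in>sets lebesgue. M = lebesgue_on S)"

definition ensemble :: "'n::finite opfam \<Rightarrow> bool" where
  "ensemble E \<longleftrightarrow>
     (discrete_index (index E) \<or> continuous_index (index E)) \<and>
     oper E \<in> borel_measurable (index E) \<and>
     (\<forall>x\<in>space (index E). state (oper E x)) \<and>
     has_bochner_integral (index E) (\<lambda>x. trace (oper E x)) 1"

definition povm :: "'n::finite opfam \<Rightarrow> bool" where
  "povm P \<longleftrightarrow>
     (discrete_index (index P) \<or> continuous_index (index P)) \<and>
     oper P \<in> borel_measurable (index P) \<and>
     (\<forall>y\<in>space (index P). effect (oper P y)) \<and>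
     has_bochner_integral (index P) (oper P) (mat 1)"

definition average_state :: "'n::finite opfam \<Rightarrow> complex^'n^'n" where
  "average_state E = (\<integral>x. oper E x \<partial>index E)"

definition joint_prob :: "'n::finite opfam \<Rightarrow> 'n opfam \<Rightarrow> real \<Rightarrow> real \<Rightarrow> real" where
  "joint_prob E P x y = Re (trace (oper E x ** oper P y))"

definition ens_prob :: "'n::finite opfam \<Rightarrow> real \<Rightarrow> real" where
  "ens_prob E x = Re (trace (oper E x))"

definition out_prob :: "'n::finite opfam \<Rightarrow> 'n opfam \<Rightarrow> real \<Rightarrow> real" where
  "out_prob E P y = Re (trace (average_state E ** oper P y))"

definition info_density :: "'n::finite opfam \<Rightarrow> 'n opfam \<Rightarrow> real \<times> real \<Rightarrow> real" where
  "info_density E P = (\<lambda>(x, y).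
     if joint_prob E P x y = 0 then 0
     else joint_prob E P x y * log 2 (joint_prob E P x y / (ens_prob E x * out_prob E P y)))"

text \<open>
  The mutual information is the integral of the density over the product of the index
  measures. It is taken in the extended reals, as positive part minus negative part
  (\<open>ennreal\<close> maps negative reals to 0), so that no integrability has to be presupposed:
  a Bochner integral would silently be 0 if the integral diverged.
\<close>

definition mutual_information :: "'n::finite opfam \<Rightarrow> 'n opfam \<Rightarrow> ereal" where
  "mutual_information E P =
     enn2ereal (\<integral>\<^sup>+z. ennreal (info_density E P z) \<partial>(index E \<Otimes>\<^sub>M index P)) -
     enn2ereal (\<integral>\<^sup>+z. ennreal (- info_density E P z) \<partial>(index E \<Otimes>\<^sub>M index P))"

definition accessible_information :: "'n::finite opfam \<Rightarrow> ereal" where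
  "accessible_information E = (SUP P\<in>{P. povm P}. mutual_information E P)"

definition informational_power :: "'n::finite opfam \<Rightarrow> ereal" where
  "informational_power P = (SUP E\<in>{E. ensemble E}. mutual_information E P)"

definition labels :: "nat \<Rightarrow> real set" where
  "labels m = real ` {1..m}"

definition sic_set :: "real \<Rightarrow> 'n::finite opfam \<Rightarrow> bool" where
  "sic_set l F \<longleftrightarrow>
     index F = count_space (labels (CARD('n)^2)) \<and>
     (\<forall>x\<in>labels (CARD('n)^2).
        psd (oper F x) \<and> rank (oper F x) = 1 \<and> trace (oper F x) = of_real l) \<and>
     (\<forall>x\<in>labels (CARD('n)^2). \<forall>y\<in>labels (CARD('n)^2). x \<noteq> y \<longrightarrow>
        trace (oper F x ** oper F y) = of_real (l^2 / (real CARD('n) + 1)))"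

definition sic_ensemble :: "'n::finite opfam \<Rightarrow> bool" where
  "sic_ensemble E \<longleftrightarrow> sic_set (1 / (real CARD('n))^2) E"

definition sic_povm :: "'n::finite opfam \<Rightarrow> bool" where
  "sic_povm P \<longleftrightarrow> sic_set (1 / real CARD('n)) P"

definition orthonormal_basis :: "(real \<Rightarrow> complex^'n) \<Rightarrow> bool" where
  "orthonormal_basis e \<longleftrightarrow>
     (\<forall>x\<in>labels CARD('n). \<forall>y\<in>labels CARD('n). hinner (e x) (e y) = (if x = y then 1 else 0)) \<and>
     vec.span (e ` labels CARD('n)) = UNIV"

definition orthonormal_povm :: "'n::finite opfam \<Rightarrow> bool" where
  "orthonormal_povm P \<longleftrightarrow>
     index P = count_space (labels CARD('n)) \<and>
     (\<exists>e. orthonormal_basis e \<and> (\<forall>y\<in>labels CARD('n). oper P y = ketbra (e y)))"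

definition orthonormal_ensemble :: "'n::finite opfam \<Rightarrow> bool" where
  "orthonormal_ensemble E \<longleftrightarrow>
     index E = count_space (labels CARD('n)) \<and>
     (\<exists>e. orthonormal_basis e \<and>
        (\<forall>x\<in>labels CARD('n). oper E x = (1 / real CARD('n)) *\<^sub>R ketbra (e x)))"

end

theory Submission
  imports Defs
begin

text \<open>
  A SIC set is a tight frame and a 2-design up to scale: the outcome probabilities
  \<open>p\<^sub>x = Tr (X\<^sub>x \<Pi>)\<close> of a positive operator have collision sum
  \<open>\<Sum>p\<^sub>x\<^sup>2 = \<lambda>\<^sup>2 d / (d + 1) (Tr \<Pi>\<^sup>2 + (Tr \<Pi>)\<^sup>2) \<le> 2 \<lambda>\<^sup>2 d / (d + 1) (Tr \<Pi>)\<^sup>2\<close>.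
  Only the upper bound is needed, and it follows from the nonnegativity of the Hilbert--Schmidt
  norm of \<open>\<Pi> - ((d + 1) / (\<lambda>\<^sup>2 d)) \<Sum>p\<^sub>x X\<^sub>x + (Tr \<Pi>) 1\<close>.
  Against the uniform distribution on \<open>d\<^sup>2\<close> points the conditional distributions of the
  SIC label thus have order-2 Renyi divergence at most \<open>log (2d / (d + 1))\<close>, which bounds the
  mutual information.

  In dimension 3 each vector of the Hesse SIC has one vanishing coordinate in the standard basis and
  two of equal modulus, so every nonzero joint probability exceeds the product of its
  marginals by the same factor \<open>3 / 2\<close>.
\<close>

subsection \<open>An upper bound for the mutual information\<close>

text \<open>Pointwise, the positive part of \<open>f\<close> lies below that of \<open>g\<close> and
  the negative part above. Both parts of \<open>g\<close> have finite integral, so the subtraction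
  is monotone even if the negative part of \<open>f\<close> has infinite integral. With one index
  finite, \<open>mutual_information\<close> takes the form of the left side.\<close>

lemma nn_integral_diff_le_integral:
  fixes f g :: "'b \<Rightarrow> 'a \<Rightarrow> real"
  assumes int: "\<And>b. b \<in> B \<Longrightarrow> integrable M (g b)"
    and le: "\<And>b. b \<in> B \<Longrightarrow> AE a in M. f b a \<le> g b a"
  shows "enn2ereal (\<Sum>b\<in>B. \<integral>\<^sup>+a. ennreal (f b a) \<partial>M) -
         enn2ereal (\<Sum>b\<in>B. \<integral>\<^sup>+a. ennreal (- f b a) \<partial>M) \<le> ereal (\<Sum>b\<in>B. \<integral>a. g b a \<partial>M)"
proof -
  define U where "U b = (\<integral>a. max 0 (g b a) \<partial>M)" for b
  define V where "V b = (\<integral>a. max 0 (- g b a) \<partial>M)" for b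
  have pos: "ennreal (max 0 x) = ennreal x" for x :: real
    by (simp add: max_def ennreal_neg)
  have U: "(\<integral>\<^sup>+a. ennreal (g b a) \<partial>M) = ennreal (U b)" if "b \<in> B" for b
    using nn_integral_eq_integral[of M "\<lambda>a. max 0 (g b a)"] int[OF that]
    by (simp add: U_def pos)
  have V: "(\<integral>\<^sup>+a. ennreal (- g b a) \<partial>M) = ennreal (V b)" if "b \<in> B" for b
    using nn_integral_eq_integral[of M "\<lambda>a. max 0 (- g b a)"] int[OF that]
    by (simp add: V_def pos)
  have nonneg: "0 \<le> U b" "0 \<le> V b" for b
    by (auto simp: U_def V_def)
  have UV: "U b - V b = (\<integral>a. g b a \<partial>M)" if "b \<in> B" for b
  proof -
    have "U b - V b = (\<integral>a. max 0 (g b a) - max 0 (- g b a) \<partial>M)"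
      unfolding U_def V_def using int[OF that] by (subst Bochner_Integration.integral_diff) auto
    also have "\<dots> = (\<integral>a. g b a \<partial>M)"
      by (intro Bochner_Integration.integral_cong) auto
    finally show ?thesis .
  qed
  have "(\<Sum>b\<in>B. \<integral>\<^sup>+a. ennreal (f b a) \<partial>M) \<le> (\<Sum>b\<in>B. ennreal (U b))"
  proof (rule sum_mono)
    fix b assume b: "b \<in> B"
    have "(\<integral>\<^sup>+a. ennreal (f b a) \<partial>M) \<le> (\<integral>\<^sup>+a. ennreal (g b a) \<partial>M)"
      using le[OF b] by (intro nn_integral_mono_AE) (auto elim!: eventually_mono intro: ennreal_leI)
    then show "(\<integral>\<^sup>+a. ennreal (f b a) \<partial>M) \<le> ennreal (U b)" by (simp add: U b)
  qed
  also have "\<dots> = ennreal (sum U B)" by (intro sum_ennreal) (use nonneg in auto)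
  finally have 1: "enn2ereal (\<Sum>b\<in>B. \<integral>\<^sup>+a. ennreal (f b a) \<partial>M) \<le> ereal (sum U B)"
    by (metis enn2ereal_ennreal less_eq_ennreal.rep_eq nonneg(1) sum_nonneg)
  have "(\<Sum>b\<in>B. ennreal (V b)) \<le> (\<Sum>b\<in>B. \<integral>\<^sup>+a. ennreal (- f b a) \<partial>M)"
  proof (rule sum_mono)
    fix b assume b: "b \<in> B"
    have "(\<integral>\<^sup>+a. ennreal (- g b a) \<partial>M) \<le> (\<integral>\<^sup>+a. ennreal (- f b a) \<partial>M)"
      using le[OF b] by (intro nn_integral_mono_AE) (auto elim!: eventually_mono intro: ennreal_leI)
    then show "ennreal (V b) \<le> (\<integral>\<^sup>+a. ennreal (- f b a) \<partial>M)" by (simp add: V b)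
  qed
  moreover have "(\<Sum>b\<in>B. ennreal (V b)) = ennreal (sum V B)"
    by (intro sum_ennreal) (use nonneg in auto)
  ultimately have 2: "ereal (sum V B) \<le> enn2ereal (\<Sum>b\<in>B. \<integral>\<^sup>+a. ennreal (- f b a) \<partial>M)"
    by (metis enn2ereal_ennreal less_eq_ennreal.rep_eq nonneg(2) sum_nonneg)
  have "enn2ereal (\<Sum>b\<in>B. \<integral>\<^sup>+a. ennreal (f b a) \<partial>M) -
        enn2ereal (\<Sum>b\<in>B. \<integral>\<^sup>+a. ennreal (- f b a) \<partial>M) \<le> ereal (sum U B) - ereal (sum V B)"
    using 1 2 by (rule ereal_minus_mono)
  also have "\<dots> = ereal (\<Sum>b\<in>B. \<integral>a. g b a \<partial>M)"
    using UV by (simp add: sum_subtractf[symmetric])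
  finally show ?thesis .
qed

text \<open>Write \<open>p / (m * q)\<close> as the product of \<open>c\<close>,
  \<open>p / (c * m * u)\<close> and \<open>u / q\<close>, and bound the last two logarithms by
  \<open>ln t \<le> t - 1\<close>. Equality holds when \<open>p = c * m * u\<close> and
  \<open>q = u\<close>, which is what the nonzero joint probabilities of the extremal pairs below
  satisfy.\<close>

lemma log_ratio_le:
  fixes p m q c u :: real
  assumes "0 < p" "0 < m" "0 < q" "0 < c" "0 < u"
  shows "log 2 (p / (m * q)) \<le> log 2 c + (p / (c * m * u) + u / q - 2) / ln 2"
proof -
  have "ln (p / (m * q)) = ln c + ln (p / (c * m * u)) + ln (u / q)"
    using assms by (simp add: ln_mult ln_div)
  moreover have "ln (p / (c * m * u)) \<le> p / (c * m * u) - 1" "ln (u / q) \<le> u / q - 1"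
    using assms by (auto intro!: ln_le_minus_one)
  ultimately have "ln (p / (m * q)) \<le> ln c + (p / (c * m * u) + u / q - 2)" by linarith
  then show ?thesis
    by (simp add: log_def divide_right_mono flip: add_divide_distrib)
qed

text \<open>
  The joint weights \<open>p b a\<close> have marginals \<open>m\<close> and \<open>q\<close>. Comparing \<open>q\<close> with the uniform
  weight \<open>u\<close> and bounding \<open>ln\<close> by its tangent at 1 avoids Jensen's inequality and any
  integrability assumption on the information density itself.
\<close>

lemma collision_bound_information_le:
  fixes p :: "'b \<Rightarrow> 'a \<Rightarrow> real"
  assumes B: "finite B" and u: "0 < u" "u * real (card B) = 1" and c: "0 < c"
    and int: "\<And>b. b \<in> B \<Longrightarrow> integrable M (p b)"
    and nonneg: "\<And>a b. a \<in> space M \<Longrightarrow> b \<in> B \<Longrightarrow> 0 \<le> p b a"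
    and m: "\<And>a. a \<in> space M \<Longrightarrow> m a = (\<Sum>b\<in>B. p b a)"
    and total: "(\<integral>a. m a \<partial>M) = 1"
    and q: "\<And>b. b \<in> B \<Longrightarrow> q b = (\<integral>a. p b a \<partial>M)"
    and collision: "\<And>a. a \<in> space M \<Longrightarrow> (\<Sum>b\<in>B. (p b a)\<^sup>2) \<le> c * u * (m a)\<^sup>2"
  defines "f \<equiv> \<lambda>b a. if p b a = 0 then 0 else p b a * log 2 (p b a / (m a * q b))"
  shows "enn2ereal (\<Sum>b\<in>B. \<integral>\<^sup>+a. ennreal (f b a) \<partial>M) -
         enn2ereal (\<Sum>b\<in>B. \<integral>\<^sup>+a. ennreal (- f b a) \<partial>M) \<le> ereal (log 2 c)"
proof -
  \<comment> \<open>\<open>p b a\<close> times the bound of \<open>log_ratio_le\<close>, expanded so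
    that the only functions to integrate are \<open>p b a\<close> and
    \<open>(p b a)\<^sup>2 / m a\<close>.\<close>
  define g where "g b a = p b a * log 2 c + ((p b a)\<^sup>2 / m a / (c * u) + p b a * (u / q b) - p b a * 2) / ln 2"
    for b a
  have ple: "p b a \<le> m a" if "a \<in> space M" "b \<in> B" for a b
    using that B nonneg by (auto simp: m intro!: member_le_sum)
  have m_int: "integrable M m"
    by (rule Bochner_Integration.integrable_cong[THEN iffD1, OF refl _ Bochner_Integration.integrable_sum[OF int]])
      (auto simp: m)
  \<comment> \<open>From \<open>p b a \<le> m a\<close> follows
    \<open>(p b a)\<^sup>2 / m a \<le> p b a\<close>, so \<open>p b\<close> itself dominates; where
    \<open>m a = 0\<close> the quotient is 0.\<close>
  have sq_int: "integrable M (\<lambda>a. (p b a)\<^sup>2 / m a)" if b: "b \<in> B" for b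
  proof (rule Bochner_Integration.integrable_bound[OF int[OF b]])
    show "(\<lambda>a. (p b a)\<^sup>2 / m a) \<in> borel_measurable M"
      using int[OF b] m_int by measurable
    show "AE a in M. norm ((p b a)\<^sup>2 / m a) \<le> norm (p b a)"
    proof (rule AE_I2)
      fix a assume a: "a \<in> space M"
      have "0 \<le> p b a" "p b a \<le> m a" using nonneg ple a b by auto
      then have "(p b a)\<^sup>2 \<le> p b a * m a" by (simp add: power2_eq_square mult_left_mono)
      then show "norm ((p b a)\<^sup>2 / m a) \<le> norm (p b a)"
        using \<open>0 \<le> p b a\<close> \<open>p b a \<le> m a\<close>
        by (cases "m a = 0") (auto simp: divide_le_eq)
    qed
  qed
  have g_hbi: "has_bochner_integral M (g b)
      (q b * log 2 c + ((\<integral>a. (p b a)\<^sup>2 / m a \<partial>M) / (c * u) + q b * (u / q b) - q b * 2) / ln 2)"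
    if b: "b \<in> B" for b
    unfolding g_def
    by (intro has_bochner_integral_add has_bochner_integral_diff has_bochner_integral_divide_zero
        has_bochner_integral_mult_left)
      (simp_all add: q b int sq_int has_bochner_integral_integrable)
  have g_int: "integrable M (g b)" if "b \<in> B" for b
    using g_hbi[OF that] by (simp add: has_bochner_integral_iff)
  have AEle: "AE a in M. f b a \<le> g b a" if b: "b \<in> B" for b
  proof (cases "q b = 0")
    case True
    \<comment> \<open>A label of total weight 0 has \<open>p b\<close> zero almost everywhere, so
      the divisions by \<open>q b = 0\<close> in \<open>f\<close> and \<open>g\<close> matter on a
      null set only.\<close>
    then have "AE a in M. p b a = 0"
      using q[OF b] integral_nonneg_eq_0_iff_AE[OF int[OF b]] nonneg b by auto
    then show ?thesis by (rule eventually_mono) (simp add: f_def g_def)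
  next
    case False
    then have q0: "0 < q b"
      using q[OF b] nonneg b by (metis Bochner_Integration.integral_nonneg order_le_less)
    show ?thesis
    proof (rule AE_I2)
      fix a assume a: "a \<in> space M"
      show "f b a \<le> g b a"
      proof (cases "p b a = 0")
        case False
        then have p0: "0 < p b a" using nonneg a b by (simp add: order_less_le)
        then have m0: "0 < m a" using ple a b by force
        have "f b a \<le> p b a * (log 2 c + (p b a / (c * m a * u) + u / q b - 2) / ln 2)"
          using mult_left_mono[OF log_ratio_le[OF p0 m0 q0 c u(1)]] p0 by (simp add: f_def)
        also have "\<dots> = g b a"
          using p0 m0 q0 c u by (simp add: g_def field_simps power2_eq_square)
        finally show ?thesis .
      qed (simp add: f_def g_def)
    qed
  qed
  have g_eq: "(\<integral>a. g b a \<partial>M) =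
      q b * log 2 c + ((\<integral>a. (p b a)\<^sup>2 / m a \<partial>M) / (c * u) + q b * (u / q b) - q b * 2) / ln 2"
    if "b \<in> B" for b
    using g_hbi[OF that] by (rule has_bochner_integral_integral_eq)
  have q_sum: "(\<Sum>b\<in>B. q b) = 1"
  proof -
    have "(\<Sum>b\<in>B. q b) = (\<integral>a. (\<Sum>b\<in>B. p b a) \<partial>M)"
      using int by (simp add: q)
    also have "\<dots> = (\<integral>a. m a \<partial>M)"
      by (intro Bochner_Integration.integral_cong) (auto simp: m)
    finally show ?thesis using total by simp
  qed
  have sq_sum: "(\<Sum>b\<in>B. (\<integral>a. (p b a)\<^sup>2 / m a \<partial>M)) \<le> c * u"
  proof -
    have "(\<Sum>b\<in>B. (\<integral>a. (p b a)\<^sup>2 / m a \<partial>M)) = (\<integral>a. (\<Sum>b\<in>B. (p b a)\<^sup>2 / m a) \<partial>M)"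
      using sq_int by simp
    also have "\<dots> \<le> (\<integral>a. c * u * m a \<partial>M)"
    proof (rule integral_mono)
      fix a assume a: "a \<in> space M"
      have "0 \<le> m a" using a nonneg by (simp add: m sum_nonneg)
      then show "(\<Sum>b\<in>B. (p b a)\<^sup>2 / m a) \<le> c * u * m a"
        using collision[OF a] by (cases "m a = 0") (auto simp: sum_divide_distrib[symmetric] divide_le_eq power2_eq_square)
    qed (use sq_int m_int in auto)
    finally show ?thesis using total m_int by simp
  qed
  \<comment> \<open>Each summand is \<open>u\<close>, or 0 when \<open>q b = 0\<close> because
    division by 0 yields 0; hence an inequality rather than an equation.\<close>
  have "(\<Sum>b\<in>B. q b * (u / q b)) \<le> (\<Sum>b\<in>B. u)"
    using u by (intro sum_mono) auto
  then have u_sum: "(\<Sum>b\<in>B. q b * (u / q b)) \<le> 1" using u(2) by (simp add: mult.commute)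
  \<comment> \<open>Up to the factor \<open>1 / ln 2\<close>, the correction to
    \<open>log 2 c\<close> is at most \<open>1 + 1 - 2\<close>: the collision bound gives the first
    1, the normalization of \<open>u\<close> the second, and the total weight of \<open>q\<close>
    the 2.\<close>
  have "(\<Sum>b\<in>B. \<integral>a. g b a \<partial>M) =
    log 2 c + ((\<Sum>b\<in>B. (\<integral>a. (p b a)\<^sup>2 / m a \<partial>M)) / (c * u) + (\<Sum>b\<in>B. q b * (u / q b)) - 2) / ln 2"
    by (simp add: g_eq sum.distrib sum_subtractf sum_divide_distrib[symmetric] q_sum
        sum_distrib_left[symmetric] sum_distrib_right[symmetric] cong: sum.cong)
  also have "\<dots> \<le> log 2 c"
  proof -
    have "(\<Sum>b\<in>B. (\<integral>a. (p b a)\<^sup>2 / m a \<partial>M)) / (c * u) \<le> 1"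
      using sq_sum c u by (simp add: divide_le_eq)
    then show ?thesis using u_sum by (simp add: divide_le_0_iff)
  qed
  finally have "ereal (\<Sum>b\<in>B. \<integral>a. g b a \<partial>M) \<le> ereal (log 2 c)" by simp
  with nn_integral_diff_le_integral[of B M g f, OF g_int AEle] show ?thesis
    by (rule order_trans)
qed

section \<open>Integration over a product with a finite index\<close>

lemma sigma_finite_completion:
  assumes "sigma_finite_measure M"
  shows "sigma_finite_measure (completion M)"
proof -
  \<comment> \<open>Lebesgue measure is the completion of \<open>lborel\<close>. A countable cover
    by sets of finite measure serves the completion as well, since it agrees with \<open>M\<close>
    on \<open>sets M\<close>.\<close>
  obtain S where S: "countable S" "S \<subseteq> sets M" "\<Union>S = space M" "\<forall>a\<in>S. emeasure M a \<noteq> \<infinity>"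
    using sigma_finite_measure.sigma_finite_countable[OF assms] by blast
  show ?thesis
    using S by unfold_locales (auto intro!: exI[of _ S])
qed

lemma sigma_finite_index:
  assumes "discrete_index M \<or> continuous_index M"
  shows "sigma_finite_measure M"
  using assms
proof
  assume "discrete_index M"
  then show ?thesis
    by (auto simp: discrete_index_def intro: sigma_finite_measure_count_space_countable)
next
  assume "continuous_index M"
  then show ?thesis
    by (auto simp: continuous_index_def intro!: sigma_finite_measure_restrict_space
        sigma_finite_completion sigma_finite_lborel)
qed

text \<open>A countable discrete factor reduces joint measurability to that of the slices; Tonelli
  then turns the product integral into a finite sum.\<close>

lemma nn_integral_pair_count_space_left:
  fixes h :: "'b \<times> 'a \<Rightarrow> ennreal"
  assumes M: "sigma_finite_measure M" and B: "finite B"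
    and h: "\<And>b. b \<in> B \<Longrightarrow> (\<lambda>a. h (b, a)) \<in> borel_measurable M"
  shows "(\<integral>\<^sup>+z. h z \<partial>(count_space B \<Otimes>\<^sub>M M)) = (\<Sum>b\<in>B. \<integral>\<^sup>+a. h (b, a) \<partial>M)"
proof -
  have [measurable]: "h \<in> borel_measurable (count_space B \<Otimes>\<^sub>M M)"
    using B h by (intro measurable_pair_measure_countable1) (auto intro: countable_finite)
  show ?thesis
    using B by (simp add: sigma_finite_measure.nn_integral_fst[OF M, symmetric] nn_integral_count_space_finite)
qed

lemma nn_integral_pair_count_space_right:
  fixes h :: "'a \<times> 'b \<Rightarrow> ennreal"
  assumes M: "sigma_finite_measure M" and B: "finite B"
    and h: "\<And>b. b \<in> B \<Longrightarrow> (\<lambda>a. h (a, b)) \<in> borel_measurable M"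
  shows "(\<integral>\<^sup>+z. h z \<partial>(M \<Otimes>\<^sub>M count_space B)) = (\<Sum>b\<in>B. \<integral>\<^sup>+a. h (a, b) \<partial>M)"
proof -
  \<comment> \<open>Measurability is checked with the discrete factor in front and carried over by
    swapping the coordinates.\<close>
  have "(\<lambda>z. h (snd z, fst z)) \<in> borel_measurable (count_space B \<Otimes>\<^sub>M M)"
    using B h by (intro measurable_pair_measure_countable1) (auto intro: countable_finite)
  then have "h \<in> borel_measurable (M \<Otimes>\<^sub>M count_space B)"
    by (subst measurable_pair_swap_iff) (simp add: case_prod_unfold)
  then have "(\<integral>\<^sup>+z. h z \<partial>(M \<Otimes>\<^sub>M count_space B)) = (\<integral>\<^sup>+a. (\<Sum>b\<in>B. h (a, b)) \<partial>M)"
    using B sigma_finite_measure.nn_integral_fst[OF sigma_finite_measure_count_space_finite[OF B], symmetric]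
    by (simp add: nn_integral_count_space_finite)
  also have "\<dots> = (\<Sum>b\<in>B. \<integral>\<^sup>+a. h (a, b) \<partial>M)"
    using h by (rule nn_integral_sum)
  finally show ?thesis .
qed

subsection \<open>Positive semidefinite matrices\<close>

lemma hinner_matrix_vector:
  "hinner v (A *v v) = (\<Sum>i\<in>UNIV. \<Sum>j\<in>UNIV. cnj (v $ i) * A $ i $ j * v $ j)"
  by (simp add: hinner_def matrix_vector_mult_def sum_distrib_left mult.assoc)

lemma trace_mult: "trace (A ** B) = (\<Sum>i\<in>UNIV. \<Sum>j\<in>UNIV. A $ i $ j * B $ j $ i)"
  by (simp add: trace_def matrix_matrix_mult_def)

lemma trace_scaleR: "trace (c *\<^sub>R A) = c *\<^sub>R trace (A :: complex^'n^'n)"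
  by (simp add: trace_def scaleR_sum_right)

lemma trace_sum: "trace (\<Sum>x\<in>N. X x) = (\<Sum>x\<in>N. trace (X x :: complex^'n^'n))"
  unfolding trace_def sum_component by (rule sum.swap)

lemma trace_ketbra_mult: "trace (ketbra v ** A) = hinner v (A *v v)"
proof -
  have "trace (ketbra v ** A) = (\<Sum>i\<in>UNIV. \<Sum>j\<in>UNIV. v $ i * cnj (v $ j) * A $ j $ i)"
    by (simp add: trace_mult ketbra_def)
  also have "\<dots> = (\<Sum>j\<in>UNIV. \<Sum>i\<in>UNIV. v $ i * cnj (v $ j) * A $ j $ i)"
    by (rule sum.swap)
  finally show ?thesis
    by (simp add: hinner_matrix_vector mult_ac)
qed

lemma psd_diag_nonneg:
  assumes "psd (A :: complex^'n^'n)"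
  shows "A $ i $ i \<in> \<real>\<^sub>\<ge>\<^sub>0"
proof -
  have "hinner (axis i 1) (A *v axis i 1) = A $ i $ i"
    by (simp add: hinner_matrix_vector axis_def if_distrib [of cnj] if_distrib [of "\<lambda>x. x * _"]
        if_distrib [of "\<lambda>x. _ * x"] cong: if_cong)
  then show ?thesis using assms by (metis psd_def)
qed

text \<open>A vector supported on \<open>i\<close> and \<open>j\<close> sees only a principal 2-by-2
  block. Suitable \<open>a\<close> and \<open>b\<close> yield hermiticity and the sign of the
  minor.\<close>

lemma psd_two_coordinates:
  assumes "psd (A :: complex^'n^'n)" and "i \<noteq> j"
  shows "cnj a * a * A $ i $ i + cnj a * b * A $ i $ j + cnj b * a * A $ j $ i + cnj b * b * A $ j $ j
           \<in> \<real>\<^sub>\<ge>\<^sub>0"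
proof -
  define v where "v = (\<chi> k. if k = i then a else if k = j then b else 0)"
  have v0: "v $ k = 0" if "k \<notin> {i, j}" for k using that by (simp add: v_def)
  have "hinner v (A *v v) = (\<Sum>k\<in>{i, j}. \<Sum>l\<in>{i, j}. cnj (v $ k) * A $ k $ l * v $ l)"
    unfolding hinner_matrix_vector
    by (rule sum.mono_neutral_cong_right; (rule sum.mono_neutral_right)?) (auto simp: v0)
  also have "\<dots> = cnj a * a * A $ i $ i + cnj a * b * A $ i $ j + cnj b * a * A $ j $ i
      + cnj b * b * A $ j $ j"
    using assms(2) by (simp add: v_def algebra_simps)
  finally show ?thesis using assms by (metis psd_def)
qed

lemma psd_hermitian:
  assumes "psd (A :: complex^'n^'n)"
  shows "A $ j $ i = cnj (A $ i $ j)"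
proof (cases "i = j")
  case True
  then show ?thesis
    using psd_diag_nonneg[OF assms, of i] by (auto simp: complex_nonneg_Reals_iff complex_eq_iff)
next
  case False
  \<comment> \<open>Reality of the form at \<open>(1, 1)\<close> makes the imaginary parts of the
    two off-diagonal entries cancel; reality at \<open>(1, \<i>)\<close> makes their real parts
    agree.\<close>
  show ?thesis
    using psd_two_coordinates[OF assms False, of 1 1] psd_two_coordinates[OF assms False, of 1 \<i>]
      psd_diag_nonneg[OF assms, of i] psd_diag_nonneg[OF assms, of j]
    by (auto simp: complex_nonneg_Reals_iff complex_eq_iff)
qed

lemma psd_minor:
  assumes "psd (A :: complex^'n^'n)"
  shows "(cmod (A $ i $ j))\<^sup>2 \<le> Re (A $ i $ i) * Re (A $ j $ j)"
proof (cases "i = j \<or> A $ i $ j = 0")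
  case True
  then show ?thesis
    using psd_diag_nonneg[OF assms, of i] psd_diag_nonneg[OF assms, of j]
    by (auto simp: complex_nonneg_Reals_iff cmod_eq_Re power2_eq_square)
next
  case False
  define z where "z = A $ i $ j"
  define w where "w = (cmod z)\<^sup>2"
  have w: "0 < w" using False by (simp add: w_def z_def)
  have zz: "z * cnj z = of_real w" by (simp only: w_def complex_norm_square)
  \<comment> \<open>The test vector has entry \<open>- t * z\<close> at \<open>i\<close> and 1 at
    \<open>j\<close>; the factor \<open>z\<close> makes both cross terms equal to
    \<open>- t * w\<close>.\<close>
  have quad: "0 \<le> t\<^sup>2 * w * Re (A $ i $ i) - 2 * t * w + Re (A $ j $ j)" for t
  proof -
    let ?a = "- (of_real t * z)"
    have "cnj ?a * ?a * A $ i $ i + cnj ?a * 1 * A $ i $ j + cnj 1 * ?a * A $ j $ i + cnj 1 * 1 * A $ j $ j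
        = of_real (t\<^sup>2) * (z * cnj z) * A $ i $ i - of_real (2 * t) * (z * cnj z) + A $ j $ j"
      by (simp add: psd_hermitian[OF assms, of j i] z_def power2_eq_square algebra_simps)
    then show ?thesis
      using psd_two_coordinates[OF assms, of i j ?a 1] False
      by (simp add: zz complex_nonneg_Reals_iff)
  qed
  have nn: "0 \<le> Re (A $ i $ i)"
    using psd_diag_nonneg[OF assms, of i] by (simp add: complex_nonneg_Reals_iff)
  show ?thesis
  proof (cases "Re (A $ i $ i) = 0")
    case True
    \<comment> \<open>With a vanishing diagonal entry the bound is affine in \<open>t\<close> with
      slope \<open>- 2 * w\<close>; this \<open>t\<close> gives it the value -1, a
      contradiction.\<close>
    then show ?thesis using quad[of "(Re (A $ j $ j) + 1) / (2 * w)"] w by simp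
  next
    case False
    with nn have pos: "0 < Re (A $ i $ i)" by simp
    \<comment> \<open>\<open>t = 1 / Re (A $ i $ i)\<close> minimizes the quadratic.\<close>
    have "0 \<le> Re (A $ j $ j) - w / Re (A $ i $ i)"
      using quad[of "1 / Re (A $ i $ i)"] pos by (simp add: power2_eq_square field_simps)
    then have "w \<le> Re (A $ i $ i) * Re (A $ j $ j)" using pos by (simp add: field_simps)
    then show ?thesis by (simp add: w_def z_def)
  qed
qed

lemma norm_matrix_power2: "(norm (A :: complex^'n^'m))\<^sup>2 = (\<Sum>i\<in>UNIV. \<Sum>j\<in>UNIV. (cmod (A $ i $ j))\<^sup>2)"
  by (simp add: norm_vec_def L2_set_def sum_nonneg)

lemma trace_square_hermitian:
  assumes "\<And>i j. (A :: complex^'n^'n) $ j $ i = cnj (A $ i $ j)"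
  shows "trace (A ** A) = of_real ((norm A)\<^sup>2)"
proof -
  have "A $ i $ j * A $ j $ i = of_real ((cmod (A $ i $ j))\<^sup>2)" for i j
    by (metis assms complex_norm_square)
  then show ?thesis
    by (simp add: trace_mult norm_matrix_power2)
qed

lemma psd_trace_nonneg:
  assumes "psd (A :: complex^'n^'n)"
  shows "0 \<le> Re (trace A)"
  using psd_diag_nonneg[OF assms]
  by (auto simp: trace_def complex_nonneg_Reals_iff intro!: sum_nonneg)

text \<open>\<open>norm\<close> on matrices is the Hilbert-Schmidt norm, and the bounds of
  \<open>psd_minor\<close>, summed over all \<open>i\<close> and \<open>j\<close>, factor into the
  square of the trace.\<close>

lemma psd_norm_le_trace:
  assumes "psd (A :: complex^'n^'n)"
  shows "norm A \<le> Re (trace A)"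
proof (rule power2_le_imp_le)
  have "(norm A)\<^sup>2 \<le> (\<Sum>i\<in>UNIV. \<Sum>j\<in>UNIV. Re (A $ i $ i) * Re (A $ j $ j))"
    unfolding norm_matrix_power2 by (intro sum_mono psd_minor assms)
  also have "\<dots> = (Re (trace A))\<^sup>2"
    by (simp add: trace_def power2_eq_square sum_product)
  finally show "(norm A)\<^sup>2 \<le> (Re (trace A))\<^sup>2" .
qed (rule psd_trace_nonneg[OF assms])

section \<open>The trace pairing and rank-one operators\<close>

lemma bounded_bilinear_trace_mult:
  "bounded_bilinear (\<lambda>A B. trace (A ** B :: complex^'n^'n))"
proof -
  have "bilinear (\<lambda>A B. trace (A ** B :: complex^'n^'n))"
    unfolding bilinear_def
    by (auto intro!: linearI simp: trace_mult sum.distrib algebra_simps scaleR_sum_right)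
  then show ?thesis by (simp add: bilinear_conv_bounded_bilinear)
qed

lemmas trace_mult_linear =
  bounded_bilinear.add_left[OF bounded_bilinear_trace_mult]
  bounded_bilinear.add_right[OF bounded_bilinear_trace_mult]
  bounded_bilinear.diff_left[OF bounded_bilinear_trace_mult]
  bounded_bilinear.diff_right[OF bounded_bilinear_trace_mult]
  bounded_bilinear.scaleR_left[OF bounded_bilinear_trace_mult]
  bounded_bilinear.scaleR_right[OF bounded_bilinear_trace_mult]
  bounded_bilinear.sum_left[OF bounded_bilinear_trace_mult]
  bounded_bilinear.sum_right[OF bounded_bilinear_trace_mult]

text \<open>The row space has a basis of one vector, and every row is a multiple of it.\<close>

lemma rank_1_entries:
  fixes A :: "'a::field^'n^'m"
  assumes "rank A = 1"
  obtains a b where "\<And>i j. A $ i $ j = a i * b j"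
proof -
  obtain B where B: "B \<subseteq> rows A" "rows A \<subseteq> vec.span B" "card B = vec.dim (rows A)"
    using vec.basis_exists[of "rows A"] by metis
  then obtain w where w: "B = {w}"
    using assms by (auto simp: row_rank_def_gen card_1_singleton_iff)
  have "\<exists>c. row i A = c *s w" for i
  proof -
    have "row i A \<in> vec.span {w}" using B(2) w by (auto simp: rows_def)
    then show ?thesis by (auto simp: vec.span_singleton)
  qed
  then obtain c where c: "\<And>i. row i A = c i *s w" by metis
  have "A $ i $ j = c i * w $ j" for i j
    using arg_cong[OF c[of i], of "\<lambda>v. v $ j"] by (simp add: row_def)
  then show ?thesis using that by blast
qed

lemma psd_rank_1_ketbra:
  assumes psd: "psd (A :: complex^'n^'n)" and rank: "rank A = 1"
  obtains v where "A = ketbra v"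
proof -
  obtain a b where ab: "\<And>i j. A $ i $ j = a i * b j" using rank_1_entries[OF rank] by metis
  show ?thesis
  proof (cases "\<exists>i. A $ i $ i \<noteq> 0")
    case True
    then obtain i where i: "A $ i $ i \<noteq> 0" by blast
    define r where "r = Re (A $ i $ i)"
    have r: "A $ i $ i = of_real r" "0 < r"
      using i psd_diag_nonneg[OF psd, of i]
      by (auto simp: r_def complex_nonneg_Reals_iff complex_eq_iff)
    \<comment> \<open>Column \<open>i\<close> scaled by the root of the diagonal entry:
      \<open>A = ketbra v\<close> fixes \<open>v\<close> up to a phase, chosen here so that
      \<open>v $ i = sqrt r\<close> is positive.\<close>
    define v where "v = (\<chi> k. A $ k $ i / of_real (sqrt r))"
    have "A $ k $ l = ketbra v $ k $ l" for k l
    proof -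
      have "ketbra v $ k $ l = A $ k $ i * cnj (A $ l $ i) / of_real (sqrt r * sqrt r)"
        by (simp add: ketbra_def v_def del: real_sqrt_mult_self)
      also have "\<dots> = A $ k $ i * A $ i $ l / A $ i $ i"
        using r by (simp add: psd_hermitian[OF psd, of i l])
      \<comment> \<open>By the factorization of the entries,
        \<open>A $ k $ i * A $ i $ l = A $ k $ l * A $ i $ i\<close>.\<close>
      also have "\<dots> = A $ k $ l"
        using i by (simp add: ab)
      finally show ?thesis by simp
    qed
    then show ?thesis by (intro that[of v]) (simp add: vec_eq_iff)
  next
    case False
    \<comment> \<open>The minors bound every entry by diagonal entries, so \<open>A = 0\<close>,
      which is \<open>ketbra 0\<close>.\<close>
    then have "A $ k $ l = 0" for k l
      using psd_minor[OF psd, of k l] by auto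
    then show ?thesis by (intro that[of 0]) (simp add: vec_eq_iff ketbra_def)
  qed
qed

text \<open>Once \<open>A = ketbra v\<close>, the trace is the quadratic form of \<open>B\<close> at
  \<open>v\<close>. This gives the nonnegativity of joint probabilities.\<close>

lemma trace_mult_rank_1_nonneg:
  assumes "psd (A :: complex^'n^'n)" "rank A = 1" "psd B"
  shows "0 \<le> Re (trace (A ** B))"
proof -
  obtain v where "A = ketbra v" using psd_rank_1_ketbra assms by metis
  then show ?thesis
    using assms(3) by (simp add: trace_ketbra_mult psd_def complex_nonneg_Reals_iff)
qed

lemma trace_square_rank_1:
  assumes "psd (A :: complex^'n^'n)" "rank A = 1"
  shows "trace (A ** A) = (trace A)\<^sup>2"
proof -
  obtain v where "A = ketbra v" using psd_rank_1_ketbra assms by metis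
  then have "trace (A ** A) = (\<Sum>i\<in>UNIV. \<Sum>j\<in>UNIV. (v $ i * cnj (v $ i)) * (v $ j * cnj (v $ j)))"
    by (simp add: trace_mult ketbra_def mult_ac)
  also have "\<dots> = (trace A)\<^sup>2"
    by (simp add: \<open>A = ketbra v\<close> trace_def ketbra_def power2_eq_square sum_product)
  finally show ?thesis .
qed

subsection \<open>SIC sets\<close>

text \<open>The scale \<open>l\<close> stays a parameter so that SIC ensembles
  (\<open>l = 1 / d\<^sup>2\<close>) and SIC POVMs (\<open>l = 1 / d\<close>) share one
  theory.\<close>

locale sic =
  fixes l d :: real and N :: "real set" and X :: "real \<Rightarrow> complex^'n^'n"
  assumes l: "0 < l" and d: "d = real CARD('n)"
    and finite_N: "finite N" and card_N: "real (card N) = d\<^sup>2"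
    and psd: "x \<in> N \<Longrightarrow> psd (X x)"
    and rank: "x \<in> N \<Longrightarrow> rank (X x) = 1"
    and trace: "x \<in> N \<Longrightarrow> trace (X x) = of_real l"
    and overlap: "x \<in> N \<Longrightarrow> y \<in> N \<Longrightarrow> x \<noteq> y \<Longrightarrow> trace (X x ** X y) = of_real (l\<^sup>2 / (d + 1))"
begin

lemma d_pos: "0 < d" by (simp add: d)

lemma overlap_eq:
  assumes "x \<in> N" "y \<in> N"
  shows "Re (trace (X x ** X y)) = l\<^sup>2 * (d / (d + 1) * of_bool (x = y) + 1 / (d + 1))"
proof (cases "x = y")
  case True
  then have "Re (trace (X x ** X y)) = l\<^sup>2"
    using trace_square_rank_1[OF psd rank] trace assms by (simp add: power2_eq_square)
  also have "\<dots> = l\<^sup>2 * (d / (d + 1) + 1 / (d + 1))"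
    using d_pos by (simp add: field_simps)
  finally show ?thesis using True by simp
qed (simp add: overlap assms)

text \<open>The Gram matrix of the \<open>X x\<close> is \<open>l\<^sup>2 / (d + 1)\<close> times
  the sum of \<open>d\<close> times the identity and the all-ones matrix.\<close>

lemma gram:
  "Re (trace ((\<Sum>x\<in>N. a x *\<^sub>R X x) ** (\<Sum>x\<in>N. a x *\<^sub>R X x))) =
     l\<^sup>2 / (d + 1) * (d * (\<Sum>x\<in>N. (a x)\<^sup>2) + (\<Sum>x\<in>N. a x)\<^sup>2)"
proof -
  have "Re (trace ((\<Sum>x\<in>N. a x *\<^sub>R X x) ** (\<Sum>x\<in>N. a x *\<^sub>R X x))) =
      (\<Sum>x\<in>N. \<Sum>y\<in>N. a x * (a y * (l\<^sup>2 * (d / (d + 1) * of_bool (y = x) + 1 / (d + 1)))))"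
    by (simp add: trace_mult_linear overlap_eq sum_distrib_left mult_ac cong: sum.cong)
  also have "\<dots> = (\<Sum>x\<in>N. \<Sum>y\<in>N. l\<^sup>2 / (d + 1) * (d * ((a x * a y) * of_bool (x = y)) + a x * a y))"
    by (intro sum.cong refl) (auto simp: algebra_simps add_divide_distrib)
  also have "\<dots> = l\<^sup>2 / (d + 1) * (d * (\<Sum>x\<in>N. \<Sum>y\<in>N. (a x * a y) * of_bool (x = y)) + (\<Sum>x\<in>N. \<Sum>y\<in>N. a x * a y))"
    by (simp only: sum_distrib_left sum.distrib distrib_left)
  also have "(\<Sum>x\<in>N. \<Sum>y\<in>N. (a x * a y) * of_bool (x = y)) = (\<Sum>x\<in>N. (a x)\<^sup>2)"
    using finite_N by (intro sum.cong refl) (simp add: of_bool_def if_distrib power2_eq_square cong: if_cong)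
  also have "(\<Sum>x\<in>N. \<Sum>y\<in>N. a x * a y) = (\<Sum>x\<in>N. a x)\<^sup>2"
    by (simp add: power2_eq_square sum_product)
  finally show ?thesis .
qed

text \<open>By \<open>gram\<close>, the sum \<open>S\<close> has
  \<open>Tr S\<^sup>2 = l\<^sup>2 * d ^ 3\<close>, and \<open>Tr S = l * d\<^sup>2\<close>. With
  these values the squared Hilbert-Schmidt norm of the difference of both sides expands to
  0.\<close>

lemma sum_eq: "(\<Sum>x\<in>N. X x) = (l * d) *\<^sub>R mat 1"
proof -
  define S where "S = (\<Sum>x\<in>N. X x)"
  define H where "H = S - (l * d) *\<^sub>R mat 1"
  have SS: "Re (trace (S ** S)) = l\<^sup>2 / (d + 1) * (d * d\<^sup>2 + (d\<^sup>2)\<^sup>2)"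
    using gram[of "\<lambda>_. 1"] by (simp add: S_def card_N)
  have S: "Re (trace S) = l * d\<^sup>2"
    by (simp add: S_def trace_sum trace card_N)
  have herm: "H $ j $ i = cnj (H $ i $ j)" for i j
    using psd_hermitian[OF psd, of _ j i] by (simp add: H_def S_def mat_def)
  have "(norm H)\<^sup>2 = Re (trace (H ** H))"
    by (simp add: trace_square_hermitian[OF herm])
  also have "\<dots> = Re (trace (S ** S)) - 2 * (l * d) * Re (trace S) + (l * d)\<^sup>2 * d"
    by (simp add: H_def trace_mult_linear trace_sub trace_add trace_scaleR trace_I d[symmetric] power2_eq_square algebra_simps)
  also have "\<dots> = 0"
    unfolding SS S using d_pos by (simp add: field_simps power2_eq_square)
  finally show ?thesis by (simp add: H_def S_def)
qed

lemma collision: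
  assumes A: "psd A"
  shows "(\<Sum>x\<in>N. (Re (trace (X x ** A)))\<^sup>2) \<le> 2 * l\<^sup>2 * d / (d + 1) * (Re (trace A))\<^sup>2"
proof -
  define a where "a x = Re (trace (X x ** A))" for x
  define t where "t = Re (trace A)"
  define Q where "Q = (\<Sum>x\<in>N. (a x)\<^sup>2)"
  \<comment> \<open>\<open>k\<close> inverts the coefficient of the identity in the Gram matrix;
    \<open>k *\<^sub>R R - t *\<^sub>R mat 1\<close> is the reconstruction of \<open>A\<close> from
    its weights \<open>a x\<close>.\<close>
  define k where "k = (d + 1) / (d * l\<^sup>2)"
  define R where "R = (\<Sum>x\<in>N. a x *\<^sub>R X x)"
  define H where "H = A - k *\<^sub>R R + t *\<^sub>R mat 1"
  have sum_a: "(\<Sum>x\<in>N. a x) = l * d * t"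
  proof -
    have "(\<Sum>x\<in>N. a x) = Re (trace ((\<Sum>x\<in>N. X x) ** A))"
      by (simp add: a_def trace_mult_linear)
    also have "\<dots> = l * d * t"
      by (simp add: sum_eq trace_mult_linear t_def)
    finally show ?thesis .
  qed
  have RR: "Re (trace (R ** R)) = l\<^sup>2 / (d + 1) * (d * Q + (l * d * t)\<^sup>2)"
    unfolding R_def gram sum_a by (simp add: Q_def)
  have RA: "Re (trace (R ** A)) = Q"
    by (simp add: R_def Q_def trace_mult_linear a_def power2_eq_square)
  have AR: "Re (trace (A ** R)) = Q" using RA by (subst trace_mul_sym)
  have R: "Re (trace R) = l * (l * d * t)"
    by (simp add: R_def trace_sum trace_scaleR trace sum_distrib_right[symmetric] sum_a)
  have herm: "H $ j $ i = cnj (H $ i $ j)" for i j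
    using psd_hermitian[OF psd, of _ j i] psd_hermitian[OF A, of j i] by (simp add: H_def R_def mat_def)
  have "0 \<le> (norm H)\<^sup>2" by simp
  also have "\<dots> = Re (trace (H ** H))"
    by (simp add: trace_square_hermitian[OF herm])
  also have "\<dots> = Re (trace (A ** A)) + k\<^sup>2 * Re (trace (R ** R)) + t\<^sup>2 * d - 2 * k * Q
      + 2 * t * t - 2 * k * t * Re (trace R)"
    by (simp add: H_def trace_mult_linear trace_sub trace_add trace_scaleR trace_I d[symmetric] power2_eq_square algebra_simps RA AR t_def[symmetric])
  \<comment> \<open>By \<open>k * l\<^sup>2 * d = d + 1\<close>, the square of \<open>R\<close>
    contributes \<open>k * Q + (d + 1) * t\<^sup>2\<close>, and the coefficients of
    \<open>t\<^sup>2\<close> add up to \<open>(d + 1) + d + 2 - 2 * (d + 1) = 1\<close>.\<close>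
  also have "\<dots> = Re (trace (A ** A)) + t\<^sup>2 - k * Q"
  proof -
    have kd: "k * l\<^sup>2 * d = d + 1" using l d_pos by (simp add: k_def)
    have "k\<^sup>2 * Re (trace (R ** R)) = k * (Q + l\<^sup>2 * d * t\<^sup>2) * ((k * l\<^sup>2 * d) / (d + 1))"
      unfolding RR by (simp add: power2_eq_square algebra_simps)
    also have "\<dots> = k * Q + (k * l\<^sup>2 * d) * t\<^sup>2"
      using d_pos kd by (simp add: distrib_left)
    finally have "k\<^sup>2 * Re (trace (R ** R)) = k * Q + (d + 1) * t\<^sup>2"
      unfolding kd .
    moreover have "2 * k * t * Re (trace R) = 2 * t\<^sup>2 * (k * l\<^sup>2 * d)"
      unfolding R by (simp add: power2_eq_square)
    ultimately show ?thesis unfolding kd by (simp add: algebra_simps power2_eq_square)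
  qed
  also have "Re (trace (A ** A)) \<le> t\<^sup>2"
    using psd_norm_le_trace[OF A] trace_square_hermitian[OF psd_hermitian[OF A]]
    by (simp add: t_def power_mono)
  finally have "k * Q \<le> 2 * t\<^sup>2" by simp
  moreover have "0 < k" using l d_pos by (simp add: k_def)
  ultimately have "Q \<le> 2 * t\<^sup>2 / k" by (simp add: pos_le_divide_eq mult.commute)
  also have "\<dots> = 2 * l\<^sup>2 * d / (d + 1) * t\<^sup>2" by (simp add: k_def)
  finally show ?thesis by (simp add: Q_def a_def t_def)
qed

end

section \<open>Upper bounds for SIC ensembles and SIC POVMs\<close>

lemma sic_set_imp_sic:
  assumes "sic_set l (F :: 'n::finite opfam)" "0 < l"
  shows "sic l (real CARD('n)) (labels (CARD('n)\<^sup>2)) (oper F)"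
  using assms by unfold_locales (auto simp: sic_set_def labels_def card_image)

text \<open>Lets the trace pairing pass under the Bochner integral, once for integrated states and
  once for integrated effects.\<close>

lemma bounded_linear_joint_prob:
  "bounded_linear (\<lambda>A. Re (trace (A ** B :: complex^'n^'n)))"
  "bounded_linear (\<lambda>A. Re (trace (B ** A :: complex^'n^'n)))"
  by (auto intro!: bounded_linear_compose[OF bounded_linear_Re]
      bounded_bilinear.bounded_linear_left[OF bounded_bilinear_trace_mult]
      bounded_bilinear.bounded_linear_right[OF bounded_bilinear_trace_mult])

text \<open>The SIC label is the finite index, the POVM outcome the integration variable. The
  average state is maximally mixed, so \<open>out_prob\<close> is the trace of the effect over
  \<open>d\<close>, and \<open>collision\<close> with \<open>l = 1 / d\<^sup>2\<close> becomes the
  collision hypothesis of the general bound for \<open>c = 2 * d / (d + 1)\<close> and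
  \<open>u = 1 / d\<^sup>2\<close>.\<close>

lemma mutual_information_sic_ensemble_le:
  fixes E P :: "'n::finite opfam"
  assumes E: "sic_ensemble E" and P: "povm P"
  shows "mutual_information E P \<le> ereal (log 2 (2 * real CARD('n) / (real CARD('n) + 1)))"
proof -
  define d where "d = real CARD('n)"
  define N where "N = labels (CARD('n)\<^sup>2)"
  define M where "M = index P"
  have d0: "0 < d" by (simp add: d_def)
  interpret sic "1 / d\<^sup>2" d N "oper E"
    using sic_set_imp_sic[of "1 / d\<^sup>2" E] E by (simp add: sic_ensemble_def d_def N_def)
  have indexE: "index E = count_space N"
    using E by (simp add: sic_ensemble_def sic_set_def N_def)
  have sf: "sigma_finite_measure M"
    using P by (auto simp: povm_def M_def intro: sigma_finite_index)
  have hbi: "has_bochner_integral M (oper P) (mat 1)"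
    and psdP: "\<And>y. y \<in> space M \<Longrightarrow> psd (oper P y)"
    using P by (auto simp: povm_def effect_def M_def)
  have avg: "average_state E = (1 / d) *\<^sub>R mat 1"
    using sum_eq finite_N d0
    by (simp add: average_state_def indexE lebesgue_integral_count_space_finite power2_eq_square)
  have out: "out_prob E P y = Re (trace (oper P y)) / d" for y
    by (simp add: out_prob_def avg trace_mult_linear)
  have marginal: "out_prob E P y = (\<Sum>x\<in>N. joint_prob E P x y)" for y
    using sum_eq d0
    by (simp add: out joint_prob_def trace_mult_linear power2_eq_square flip: Re_sum trace_mult_linear(7))
  have joint: "has_bochner_integral M (joint_prob E P x) (Re (trace (oper E x)))" for x
    using has_bochner_integral_bounded_linear[OF bounded_linear_joint_prob(2) hbi, of "oper E x"]
    by (simp add: joint_prob_def [abs_def])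
  have meas: "joint_prob E P x \<in> borel_measurable M" for x
    using joint has_bochner_integral_iff borel_measurable_integrable by blast
  have meas_out: "out_prob E P \<in> borel_measurable M"
    unfolding marginal[abs_def] using meas by measurable
  have total: "(\<integral>y. out_prob E P y \<partial>M) = 1"
  proof -
    have "(\<integral>y. out_prob E P y \<partial>M) = (\<Sum>x\<in>N. Re (trace (oper E x)))"
      using joint by (simp add: marginal has_bochner_integral_iff)
    also have "\<dots> = 1" using trace card_N d0 by simp
    finally show ?thesis .
  qed
  \<comment> \<open>The marginals are interchanged relative to \<open>info_density\<close>, because
    the \<open>m\<close> of the general bound is here the outcome marginal.\<close>
  let ?f = "\<lambda>x y. if joint_prob E P x y = 0 then 0
    else joint_prob E P x y * log 2 (joint_prob E P x y / (out_prob E P y * ens_prob E x))"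
  have f: "info_density E P (x, y) = ?f x y" for x y
    by (simp add: info_density_def mult.commute)
  have meas_f: "?f x \<in> borel_measurable M" for x
    using meas meas_out by measurable
  have "enn2ereal (\<Sum>x\<in>N. \<integral>\<^sup>+y. ennreal (?f x y) \<partial>M) - enn2ereal (\<Sum>x\<in>N. \<integral>\<^sup>+y. ennreal (- ?f x y) \<partial>M)
      \<le> ereal (log 2 (2 * d / (d + 1)))"
  proof (rule collision_bound_information_le[where u = "1 / d\<^sup>2"])
    fix y assume y: "y \<in> space M"
    show "(\<Sum>x\<in>N. (joint_prob E P x y)\<^sup>2) \<le> 2 * d / (d + 1) * (1 / d\<^sup>2) * (out_prob E P y)\<^sup>2"
      using collision[OF psdP[OF y]] d0 by (simp add: joint_prob_def out power_divide power2_eq_square mult_ac)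
    show "0 \<le> joint_prob E P x y" if "x \<in> N" for x
      using trace_mult_rank_1_nonneg[OF psd[OF that] rank[OF that] psdP[OF y]] by (simp add: joint_prob_def)
  qed (use finite_N d0 card_N joint marginal total in \<open>auto simp: has_bochner_integral_iff ens_prob_def\<close>)
  then show ?thesis
    unfolding mutual_information_def indexE M_def[symmetric] d_def[symmetric]
    by (subst (1 2) nn_integral_pair_count_space_left[OF sf finite_N]) (use meas_f in \<open>simp_all add: f\<close>)
qed

text \<open>\<open>ensemble\<close> speaks of the integral of the trace alone; on positive
  semidefinite matrices the trace dominates the norm. Hence the Bochner integral in
  \<open>average_state\<close> is genuine and not the default 0.\<close>

lemma ensemble_integrable:
  fixes E :: "'n::finite opfam"
  assumes E: "ensemble E"
  shows "integrable (index E) (oper E)"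
proof (rule Bochner_Integration.integrable_bound)
  show "integrable (index E) (\<lambda>x. trace (oper E x))" "oper E \<in> borel_measurable (index E)"
    using E by (auto simp: ensemble_def has_bochner_integral_iff)
  have "norm (oper E x) \<le> norm (trace (oper E x))" if "x \<in> space (index E)" for x
  proof -
    have "norm (oper E x) \<le> Re (trace (oper E x))"
      using E that by (auto simp: ensemble_def state_def intro: psd_norm_le_trace)
    then show ?thesis using complex_Re_le_cmod order_trans by blast
  qed
  then show "AE x in index E. norm (oper E x) \<le> norm (trace (oper E x))" by simp
qed

text \<open>The roles are exchanged: the outcome is the finite index, and \<open>collision\<close>
  with \<open>l = 1 / d\<close> is applied to the states. Completeness of the POVM makes
  \<open>ens_prob\<close> the marginal \<open>m\<close>; \<open>c\<close> and \<open>u\<close> are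
  as for ensembles.\<close>

lemma mutual_information_sic_povm_le:
  fixes E P :: "'n::finite opfam"
  assumes P: "sic_povm P" and E: "ensemble E"
  shows "mutual_information E P \<le> ereal (log 2 (2 * real CARD('n) / (real CARD('n) + 1)))"
proof -
  define d where "d = real CARD('n)"
  define N where "N = labels (CARD('n)\<^sup>2)"
  define M where "M = index E"
  have d0: "0 < d" by (simp add: d_def)
  interpret sic "1 / d" d N "oper P"
    using sic_set_imp_sic[of "1 / d" P] P by (simp add: sic_povm_def d_def N_def)
  have indexP: "index P = count_space N"
    using P by (simp add: sic_povm_def sic_set_def N_def)
  have sf: "sigma_finite_measure M"
    using E by (auto simp: ensemble_def M_def intro: sigma_finite_index)
  have psdE: "\<And>x. x \<in> space M \<Longrightarrow> psd (oper E x)"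
    using E by (auto simp: ensemble_def state_def M_def)
  have hbi: "has_bochner_integral M (oper E) (average_state E)"
    using ensemble_integrable[OF E] by (simp add: average_state_def M_def has_bochner_integral_integrable)
  have marginal: "ens_prob E x = (\<Sum>y\<in>N. joint_prob E P x y)" for x
    using sum_eq d0
    by (simp add: ens_prob_def joint_prob_def flip: Re_sum trace_mult_linear(8))
  have joint: "has_bochner_integral M (\<lambda>x. joint_prob E P x y) (out_prob E P y)" for y
    using has_bochner_integral_bounded_linear[OF bounded_linear_joint_prob(1) hbi, of "oper P y"]
    by (simp add: joint_prob_def out_prob_def)
  have meas: "(\<lambda>x. joint_prob E P x y) \<in> borel_measurable M" for y
    using joint has_bochner_integral_iff borel_measurable_integrable by blast
  have meas_ens: "ens_prob E \<in> borel_measurable M"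
    unfolding marginal[abs_def] using meas by measurable
  have total: "(\<integral>x. ens_prob E x \<partial>M) = 1"
    using E by (simp add: ens_prob_def M_def ensemble_def has_bochner_integral_iff)
  let ?f = "\<lambda>y x. if joint_prob E P x y = 0 then 0
    else joint_prob E P x y * log 2 (joint_prob E P x y / (ens_prob E x * out_prob E P y))"
  have f: "info_density E P (x, y) = ?f y x" for x y
    by (simp add: info_density_def)
  have meas_f: "?f y \<in> borel_measurable M" for y
    using meas meas_ens by measurable
  have "enn2ereal (\<Sum>y\<in>N. \<integral>\<^sup>+x. ennreal (?f y x) \<partial>M) - enn2ereal (\<Sum>y\<in>N. \<integral>\<^sup>+x. ennreal (- ?f y x) \<partial>M)
      \<le> ereal (log 2 (2 * d / (d + 1)))"
  proof (rule collision_bound_information_le[where u = "1 / d\<^sup>2"])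
    fix x assume x: "x \<in> space M"
    show "(\<Sum>y\<in>N. (joint_prob E P x y)\<^sup>2) \<le> 2 * d / (d + 1) * (1 / d\<^sup>2) * (ens_prob E x)\<^sup>2"
      using collision[OF psdE[OF x]] d0
      by (simp add: joint_prob_def ens_prob_def trace_mul_sym[of "oper E x"] power_divide power2_eq_square mult_ac)
    show "0 \<le> joint_prob E P x y" if "y \<in> N" for y
      using trace_mult_rank_1_nonneg[OF psd[OF that] rank[OF that] psdE[OF x]]
      by (simp add: joint_prob_def trace_mul_sym[of "oper E x"])
  qed (use finite_N d0 card_N joint marginal total in \<open>auto simp: has_bochner_integral_iff\<close>)
  then show ?thesis
    unfolding mutual_information_def indexP M_def[symmetric] d_def[symmetric]
    by (subst (1 2) nn_integral_pair_count_space_right[OF sf finite_N]) (use meas_f in \<open>simp_all add: f\<close>)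
qed

subsection \<open>The Hesse SIC\<close>

text \<open>A primitive cube root of unity, in Cartesian form so that moduli can be
  computed.\<close>

definition omega :: complex where "omega = Complex (- 1 / 2) (sqrt 3 / 2)"

text \<open>The label modulo 3 places the zero and the quotient sets the phase. Label 9 has exponent
  3, that is phase 1, so 3, 6 and 9 also run through all three phases. The vectors are unnormalized,
  with squared norm 2.\<close>

definition hesse_vector :: "nat \<Rightarrow> complex^3" where
  "hesse_vector n =
     (if n mod 3 = 0 then vector [0, 1, omega ^ (n div 3)]
      else if n mod 3 = 1 then vector [omega ^ (n div 3), 0, 1]
      else vector [1, omega ^ (n div 3), 0])"

text \<open>Each operator has trace \<open>2 * s\<close>, so \<open>s = 1 / 18\<close> gives the
  ensemble and \<open>s = 1 / 6\<close> the POVM.\<close>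

definition hesse :: "real \<Rightarrow> 3 opfam" where
  "hesse s = (count_space (labels 9), \<lambda>x. s *\<^sub>R ketbra (hesse_vector (nat \<lfloor>x\<rfloor>)))"

definition standard_basis :: "real \<Rightarrow> complex^3" where
  "standard_basis x = axis (if x = 1 then 1 else if x = 2 then 2 else 3) 1"

text \<open>\<open>t = 1\<close> gives the orthonormal POVM and \<open>t = 1 / 3\<close> the
  orthonormal ensemble.\<close>

definition standard :: "real \<Rightarrow> 3 opfam" where
  "standard t = (count_space (labels 3), \<lambda>x. t *\<^sub>R ketbra (standard_basis x))"

lemma omega_power:
  "omega ^ 2 = Complex (- 1 / 2) (- sqrt 3 / 2)" "omega ^ 3 = 1"
proof -
  show "omega ^ 2 = Complex (- 1 / 2) (- sqrt 3 / 2)"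
    by (simp add: omega_def power2_eq_square complex_eq_iff)
  then show "omega ^ 3 = 1"
    by (simp add: power3_eq_cube power2_eq_square omega_def complex_eq_iff)
qed

lemma labels_3: "labels 3 = {1, 2, 3}"
proof -
  have "{1..3::nat} = {1, 2, 3}" by auto
  then show ?thesis by (simp add: labels_def)
qed

lemma hinner_commute: "hinner w v = cnj (hinner v w)"
  by (simp add: hinner_def mult.commute)

lemma trace_ketbra_ketbra: "trace (ketbra v ** ketbra w) = of_real ((cmod (hinner v w))\<^sup>2)"
proof -
  have "trace (ketbra v ** ketbra w) = hinner v w * hinner w v"
    by (simp add: trace_mult ketbra_def hinner_def sum_product mult_ac)
  also have "\<dots> = hinner v w * cnj (hinner v w)" by (simp only: hinner_commute[of w v])
  finally show ?thesis by (simp only: complex_norm_square)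
qed

lemma trace_ketbra: "trace (ketbra v) = of_real ((norm v)\<^sup>2)"
proof -
  have "v $ i * cnj (v $ i) = of_real ((cmod (v $ i))\<^sup>2)" for i
    by (simp only: complex_norm_square)
  then show ?thesis
    by (simp add: trace_def ketbra_def norm_vec_def L2_set_def sum_nonneg)
qed

lemma psd_ketbra: "0 \<le> s \<Longrightarrow> psd (s *\<^sub>R ketbra v)"
  unfolding psd_def
proof
  fix w assume s: "0 \<le> s"
  have "hinner w ((s *\<^sub>R ketbra v) *v w) = trace (ketbra w ** (s *\<^sub>R ketbra v))"
    by (rule trace_ketbra_mult[symmetric])
  also have "\<dots> = of_real (s * (cmod (hinner w v))\<^sup>2)"
    by (simp add: trace_mult_linear trace_ketbra_ketbra scaleR_conv_of_real[where 'a = complex])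
  finally show "hinner w ((s *\<^sub>R ketbra v) *v w) \<in> \<real>\<^sub>\<ge>\<^sub>0" using s by simp
qed

lemma rank_ketbra:
  assumes "s \<noteq> 0" "v \<noteq> 0"
  shows "rank (s *\<^sub>R ketbra (v :: complex^'n)) = 1"
proof -
  let ?A = "s *\<^sub>R ketbra v" and ?w = "\<chi> j. cnj (v $ j)"
  have row: "row i ?A = (of_real s * v $ i) *s ?w" for i
    by (simp add: row_def ketbra_def vec_eq_iff scaleR_conv_of_real[where 'a = complex])
  have "rows ?A \<subseteq> vec.span {?w}"
    by (auto simp: rows_def row vec.span_singleton)
  then have "vec.dim (rows ?A) \<le> vec.dim {?w}"
    by (rule vec.dim_mono)
  also have "\<dots> \<le> 1" by simp
  finally have le: "vec.dim (rows ?A) \<le> 1" .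
  obtain i where i: "v $ i \<noteq> 0" using assms(2) by (auto simp: vec_eq_iff)
  then have "row i ?A $ i \<noteq> 0" using assms(1) by (simp add: row)
  then have "row i ?A \<noteq> 0" by (metis zero_index)
  then have "\<not> rows ?A \<subseteq> {0}" by (auto simp: rows_def)
  then have "vec.dim (rows ?A) \<noteq> 0" by simp
  with le show ?thesis unfolding row_rank_def_gen by linarith
qed

text \<open>Distinct vectors with the same zero have an inner product of modulus
  \<open>cmod (1 + omega ^ k)\<close> with \<open>k\<close> not divisible by 3, which is 1; vectors
  with different zeros share one coordinate, where both have modulus 1. The proof checks all
  pairs.\<close>

lemma hesse_overlap:
  assumes "m \<in> {1..9}" "n \<in> {1..9}"
  shows "(cmod (hinner (hesse_vector m) (hesse_vector n)))\<^sup>2 = (if m = n then 4 else 1)"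
proof -
  have range: "{1..9::nat} = {1, 2, 3, 4, 5, 6, 7, 8, 9}" by auto
  have om: "omega = Complex (- 1 / 2) (sqrt 3 / 2)" "omega\<^sup>2 = Complex (- 1 / 2) (- sqrt 3 / 2)" "omega ^ 3 = 1"
    using omega_power by (auto simp: omega_def)
  show ?thesis
    using assms unfolding range hesse_vector_def hinner_def sum_3
    by (elim insertE emptyE; simp add: om(2,3); simp add: om(1) cmod_power2; simp add: power2_eq_square field_simps)
qed

lemma hinner_self: "hinner v v = of_real ((norm v)\<^sup>2)"
proof -
  have "hinner v v = trace (ketbra v)"
    by (simp add: hinner_def trace_def ketbra_def mult.commute)
  then show ?thesis by (simp only: trace_ketbra)
qed

lemma hesse_sic:
  assumes s: "0 < s"
  shows "sic_set (2 * s) (hesse s)"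
proof -
  have norm: "(norm (hesse_vector m))\<^sup>2 = 2" if "m \<in> {1..9}" for m
  proof -
    \<comment> \<open>The value 4 of \<open>hesse_overlap\<close> on the diagonal is the fourth
      power of the norm.\<close>
    have "((norm (hesse_vector m))\<^sup>2)\<^sup>2 = 2\<^sup>2"
      using hesse_overlap[OF that that] unfolding hinner_self norm_of_real by simp
    then show ?thesis by (rule power2_eq_imp_eq) auto
  qed
  have nz: "hesse_vector m \<noteq> 0" if "m \<in> {1..9}" for m
    using norm[OF that] by auto
  have "oper (hesse s) (real m) = s *\<^sub>R ketbra (hesse_vector m)" for m
    by (simp add: hesse_def)
  moreover have "psd (s *\<^sub>R ketbra (hesse_vector m))" for m
    using s by (simp add: psd_ketbra)
  moreover have "rank (s *\<^sub>R ketbra (hesse_vector m)) = 1" if "m \<in> {1..9}" for m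
    using s nz[OF that] by (simp add: rank_ketbra)
  moreover have "trace (s *\<^sub>R ketbra (hesse_vector m)) = of_real (2 * s)" if "m \<in> {1..9}" for m
    by (simp add: trace_scaleR trace_ketbra norm[OF that] scaleR_conv_of_real[where 'a = complex] flip: of_real_power)
  moreover have "trace ((s *\<^sub>R ketbra (hesse_vector m)) ** (s *\<^sub>R ketbra (hesse_vector n))) =
      of_real ((2 * s)\<^sup>2 / 4)" if "m \<in> {1..9}" "n \<in> {1..9}" "m \<noteq> n" for m n
    using hesse_overlap[OF that(1,2)] that(3)
    by (simp add: trace_mult_linear trace_ketbra_ketbra scaleR_conv_of_real[where 'a = complex]
        power2_eq_square)
  ultimately show ?thesis
    unfolding sic_set_def by (auto simp: labels_def) (simp add: hesse_def labels_def)
qed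

section \<open>The standard basis as POVM and as ensemble\<close>

lemma hinner_axis: "hinner v (axis i 1) = cnj (v $ i)"
  by (simp add: hinner_def axis_def if_distrib cong: if_cong)

lemma orthonormal_standard_basis: "orthonormal_basis standard_basis"
proof -
  have "v \<in> vec.span (standard_basis ` labels 3)" for v :: "complex^3"
  proof -
    have "v = v $ 1 *s standard_basis 1 + v $ 2 *s standard_basis 2 + v $ 3 *s standard_basis 3"
      by (simp add: vec_eq_iff forall_3 standard_basis_def axis_def)
    moreover have "\<dots> \<in> vec.span (standard_basis ` labels 3)"
      by (intro vec.span_add vec.span_scale vec.span_base) (auto simp: labels_3)
    ultimately show ?thesis by simp
  qed
  moreover have "hinner (standard_basis x) (standard_basis y) = (if x = y then 1 else 0)"
    if "x \<in> labels 3" "y \<in> labels 3" for x y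
    using that by (auto simp: labels_3 standard_basis_def hinner_axis) (auto simp: axis_def)
  ultimately show ?thesis by (auto simp: orthonormal_basis_def)
qed

lemma sum_standard: "(\<Sum>x\<in>labels 3. oper (standard t) x) = t *\<^sub>R mat 1"
  by (simp add: labels_3 standard_def vec_eq_iff forall_3 ketbra_def standard_basis_def axis_def mat_def)

lemma standard_trace: "trace (oper (standard t) x) = of_real t"
  by (simp add: standard_def trace_def sum_3 ketbra_def standard_basis_def axis_def
      scaleR_conv_of_real[where 'a = complex])

lemma standard_index: "index (standard t) = count_space (labels 3)"
  by (simp add: standard_def)

lemma finite_labels: "finite (labels n)"
  by (simp add: labels_def)

lemma has_bochner_integral_count_space_finite:
  "finite A \<Longrightarrow> has_bochner_integral (count_space A) f (\<Sum>a\<in>A. f a)"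
  for f :: "'a \<Rightarrow> 'b::{banach, second_countable_topology}"
  by (simp add: has_bochner_integral_iff integrable_count_space lebesgue_integral_count_space_finite)

lemma discrete_index_labels: "discrete_index (count_space (labels n))"
  unfolding discrete_index_def using finite_labels countable_finite by blast

lemma standard_psd: "0 \<le> t \<Longrightarrow> psd (oper (standard t) x)"
  by (simp add: standard_def psd_ketbra)

lemma ensemble_standard: "ensemble (standard (1 / 3))"
  unfolding ensemble_def
proof (intro conjI ballI)
  show "has_bochner_integral (index (standard (1 / 3))) (\<lambda>x. trace (oper (standard (1 / 3)) x)) 1"
    using has_bochner_integral_count_space_finite[OF finite_labels, of 3 "\<lambda>_. 1 / 3 :: complex"]
    by (simp add: standard_index standard_trace labels_3)
qed (auto simp: discrete_index_labels state_def standard_trace standard_psd standard_index)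

lemma psd_complement_ketbra_axis: "psd (mat 1 - ketbra (axis i 1) :: complex^'n^'n)"
  unfolding psd_def
proof
  fix v :: "complex^'n"
  have "hinner v ((mat 1 - ketbra (axis i 1)) *v v) = trace (ketbra v ** (mat 1 - ketbra (axis i 1)))"
    by (rule trace_ketbra_mult[symmetric])
  also have "\<dots> = of_real ((norm v)\<^sup>2 - (cmod (v $ i))\<^sup>2)"
    by (simp add: trace_mult_linear trace_ketbra trace_ketbra_ketbra hinner_axis)
  also have "\<dots> \<in> \<real>\<^sub>\<ge>\<^sub>0"
    unfolding nonneg_Reals_of_real_iff
    using Finite_Cartesian_Product.norm_nth_le[of v i] by (simp add: power_mono)
  finally show "hinner v ((mat 1 - ketbra (axis i 1)) *v v) \<in> \<real>\<^sub>\<ge>\<^sub>0" .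
qed

lemma povm_standard: "povm (standard 1)"
  unfolding povm_def
proof (intro conjI ballI)
  show "has_bochner_integral (index (standard 1)) (oper (standard 1)) (mat 1)"
    using has_bochner_integral_count_space_finite[OF finite_labels, of 3 "oper (standard 1)"]
    by (simp add: standard_index sum_standard)
  show "effect (oper (standard 1) y)" for y
    using standard_psd[of 1 y]
    by (simp add: effect_def standard_def standard_basis_def psd_complement_ketbra_axis)
qed (auto simp: discrete_index_labels standard_index)

text \<open>The overlap is the squared modulus of a coordinate, and each coordinate is 0, 1 or a
  power of \<open>omega\<close>.\<close>

lemma hesse_standard_overlap:
  "(cmod (hinner (hesse_vector m) (standard_basis y)))\<^sup>2 \<in> {0, 1}"
proof -
  have "cmod omega = 1" by (simp add: omega_def cmod_def power_divide)
  then have "cmod (omega ^ k) = 1" for k by (simp add: norm_power)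
  then have "\<forall>i. cmod (hesse_vector m $ i) \<in> {0, 1}"
    by (simp add: hesse_vector_def forall_3)
  then show ?thesis
    by (auto simp: standard_basis_def hinner_axis)
qed

section \<open>The mutual information of the extremal pairs\<close>

lemma mutual_information_constant_ratio:
  assumes E: "index E = count_space A" "finite A" and P: "index P = count_space B" "finite B"
    and nonneg: "\<And>x y. x \<in> A \<Longrightarrow> y \<in> B \<Longrightarrow> 0 \<le> joint_prob E P x y"
    and total: "(\<Sum>x\<in>A. \<Sum>y\<in>B. joint_prob E P x y) = 1"
    and k: "1 \<le> k"
    and ratio: "\<And>x y. x \<in> A \<Longrightarrow> y \<in> B \<Longrightarrow> joint_prob E P x y \<noteq> 0 \<Longrightarrow>
      joint_prob E P x y / (ens_prob E x * out_prob E P y) = k"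
  shows "mutual_information E P = ereal (log 2 k)"
proof -
  have prod: "index E \<Otimes>\<^sub>M index P = count_space (A \<times> B)"
    using E P by (simp add: pair_measure_countable countable_finite)
  have log: "0 \<le> log 2 k" using k by simp
  \<comment> \<open>On the support of the joint distribution the logarithm is constant. As
    \<open>k \<ge> 1\<close>, the density is nonnegative, so its negative part vanishes and
    normalization leaves \<open>log 2 k\<close>.\<close>
  have dens: "info_density E P z = joint_prob E P (fst z) (snd z) * log 2 k" if "z \<in> A \<times> B" for z
    using that ratio by (auto simp: info_density_def)
  have nn: "0 \<le> info_density E P z" if "z \<in> A \<times> B" for z
    using that nonneg log by (auto simp: dens)
  have "(\<Sum>z\<in>A \<times> B. info_density E P z) = (\<Sum>x\<in>A. \<Sum>y\<in>B. joint_prob E P x y) * log 2 k"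
    by (simp add: dens sum.cartesian_product sum_distrib_right case_prod_unfold cong: sum.cong)
  then have "(\<Sum>z\<in>A \<times> B. info_density E P z) = log 2 k" by (simp add: total)
  then have pos: "(\<integral>\<^sup>+z. ennreal (info_density E P z) \<partial>count_space (A \<times> B)) = ennreal (log 2 k)"
    using E(2) P(2) nn by (simp add: nn_integral_count_space_finite)
  have neg: "(\<integral>\<^sup>+z. ennreal (- info_density E P z) \<partial>count_space (A \<times> B)) = 0"
    using nn by (auto simp: nn_integral_0_iff_AE AE_count_space ennreal_neg)
  show ?thesis
    using log by (simp add: mutual_information_def prod pos neg zero_ennreal.rep_eq)
qed

lemma hesse_marginals:
  assumes "0 < s"
  shows "(\<Sum>x\<in>labels 9. oper (hesse s) x) = (6 * s) *\<^sub>R mat 1"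
    and "x \<in> labels 9 \<Longrightarrow> Re (trace (oper (hesse s) x)) = 2 * s"
proof -
  interpret sic "2 * s" 3 "labels 9" "oper (hesse s)"
    using sic_set_imp_sic[OF hesse_sic[OF assms]] assms by simp
  show "(\<Sum>x\<in>labels 9. oper (hesse s) x) = (6 * s) *\<^sub>R mat 1" using sum_eq by simp
  show "Re (trace (oper (hesse s) x)) = 2 * s" if "x \<in> labels 9" using trace[OF that] by simp
qed

lemma hesse_standard_joint:
  "Re (trace (oper (hesse s) x ** oper (standard t) y)) \<in> {0, s * t}"
  using hesse_standard_overlap[of "nat \<lfloor>x\<rfloor>" y]
  by (auto simp: hesse_def standard_def trace_mult_linear trace_ketbra_ketbra simp flip: of_real_power)

lemma hesse_index: "index (hesse s) = count_space (labels 9)"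
  by (simp add: hesse_def)

lemma mutual_information_hesse_ensemble:
  "mutual_information (hesse (1 / 18)) (standard 1) = ereal (log 2 (3 / 2))"
proof (rule mutual_information_constant_ratio[OF hesse_index finite_labels standard_index finite_labels])
  have avg: "average_state (hesse (1 / 18)) = (1 / 3) *\<^sub>R mat 1"
    using hesse_marginals(1)[of "1 / 18"]
    by (simp add: average_state_def hesse_index lebesgue_integral_count_space_finite finite_labels)
  have out: "out_prob (hesse (1 / 18)) (standard 1) y = 1 / 3" for y
    by (simp add: out_prob_def avg trace_mult_linear standard_trace)
  have ens: "ens_prob (hesse (1 / 18)) x = 1 / 9" if "x \<in> labels 9" for x
    using that by (simp add: ens_prob_def hesse_marginals)
  fix x y
  have joint: "joint_prob (hesse (1 / 18)) (standard 1) x y \<in> {0, 1 / 18}"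
    using hesse_standard_joint[of "1 / 18" x 1 y] by (simp add: joint_prob_def)
  then show "0 \<le> joint_prob (hesse (1 / 18)) (standard 1) x y" by auto
  assume "x \<in> labels 9" "joint_prob (hesse (1 / 18)) (standard 1) x y \<noteq> 0"
  \<comment> \<open>The ratio is \<open>(1 / 18) / (1 / 9 * (1 / 3))\<close>.\<close>
  then show "joint_prob (hesse (1 / 18)) (standard 1) x y /
      (ens_prob (hesse (1 / 18)) x * out_prob (hesse (1 / 18)) (standard 1) y) = 3 / 2"
    using joint by (auto simp: ens out)
next
  have "(\<Sum>x\<in>labels 9. \<Sum>y\<in>labels 3. joint_prob (hesse (1 / 18)) (standard 1) x y) =
      Re (trace ((\<Sum>x\<in>labels 9. oper (hesse (1 / 18)) x) ** (\<Sum>y\<in>labels 3. oper (standard 1) y)))"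
    by (subst sum.swap) (simp add: joint_prob_def trace_mult_linear)
  also have "\<dots> = 1"
    by (simp add: hesse_marginals sum_standard trace_mult_linear trace_scaleR trace_I)
  finally show "(\<Sum>x\<in>labels 9. \<Sum>y\<in>labels 3. joint_prob (hesse (1 / 18)) (standard 1) x y) = 1" .
qed simp

lemma mutual_information_hesse_povm:
  "mutual_information (standard (1 / 3)) (hesse (1 / 6)) = ereal (log 2 (3 / 2))"
proof (rule mutual_information_constant_ratio[OF standard_index finite_labels hesse_index finite_labels])
  have avg: "average_state (standard (1 / 3)) = (1 / 3) *\<^sub>R mat 1"
    using sum_standard[of "1 / 3"]
    by (simp add: average_state_def standard_index lebesgue_integral_count_space_finite finite_labels)
  have out: "out_prob (standard (1 / 3)) (hesse (1 / 6)) y = 1 / 9" if "y \<in> labels 9" for y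
    using hesse_marginals(2)[of "1 / 6" y] that by (simp add: out_prob_def avg trace_mult_linear)
  fix x y
  have joint: "joint_prob (standard (1 / 3)) (hesse (1 / 6)) x y \<in> {0, 1 / 18}"
    using hesse_standard_joint[of "1 / 6" y "1 / 3" x]
    unfolding joint_prob_def by (subst trace_mul_sym) simp
  then show "0 \<le> joint_prob (standard (1 / 3)) (hesse (1 / 6)) x y" by auto
  assume "y \<in> labels 9" "joint_prob (standard (1 / 3)) (hesse (1 / 6)) x y \<noteq> 0"
  then show "joint_prob (standard (1 / 3)) (hesse (1 / 6)) x y /
      (ens_prob (standard (1 / 3)) x * out_prob (standard (1 / 3)) (hesse (1 / 6)) y) = 3 / 2"
    using joint by (auto simp: ens_prob_def out standard_trace)
next
  have "(\<Sum>x\<in>labels 3. \<Sum>y\<in>labels 9. joint_prob (standard (1 / 3)) (hesse (1 / 6)) x y) =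
      Re (trace ((\<Sum>x\<in>labels 3. oper (standard (1 / 3)) x) ** (\<Sum>y\<in>labels 9. oper (hesse (1 / 6)) y)))"
    by (simp add: joint_prob_def trace_mult_linear sum.swap[of _ "labels 3"])
  also have "\<dots> = 1"
    by (simp add: hesse_marginals sum_standard trace_mult_linear trace_scaleR trace_I)
  finally show "(\<Sum>x\<in>labels 3. \<Sum>y\<in>labels 9. joint_prob (standard (1 / 3)) (hesse (1 / 6)) x y) = 1" .
qed simp

section \<open>Passage to the suprema and tightness in dimension 3\<close>

lemma accessible_information_sic_ensemble_le:
  fixes E :: "'n::finite opfam"
  assumes "sic_ensemble E"
  shows "accessible_information E \<le> ereal (log 2 (2 * real CARD('n) / (real CARD('n) + 1)))"
  unfolding accessible_information_def
  using mutual_information_sic_ensemble_le[OF assms] by (auto intro: SUP_least)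

lemma informational_power_sic_povm_le:
  fixes P :: "'n::finite opfam"
  assumes "sic_povm P"
  shows "informational_power P \<le> ereal (log 2 (2 * real CARD('n) / (real CARD('n) + 1)))"
  unfolding informational_power_def
  using mutual_information_sic_povm_le[OF assms] by (auto intro: SUP_least)

theorem corollary2:
  shows "(\<forall>E :: 'd::finite opfam. sic_ensemble E \<longrightarrow>
            accessible_information E \<le> ereal (log 2 (2 * real CARD('d) / (real CARD('d) + 1)))) \<and>
         (\<forall>P :: 'd opfam. sic_povm P \<longrightarrow>
            informational_power P \<le> ereal (log 2 (2 * real CARD('d) / (real CARD('d) + 1)))) \<and>
         (\<exists>(E :: 3 opfam) (P :: 3 opfam).
            sic_ensemble E \<and> sic_povm P \<and>
            accessible_information E = ereal (log 2 (3 / 2)) \<and>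
            informational_power P = ereal (log 2 (3 / 2)) \<and>
            (\<exists>Q. povm Q \<and> orthonormal_povm Q \<and>
                 mutual_information E Q = accessible_information E) \<and>
            (\<exists>F. ensemble F \<and> orthonormal_ensemble F \<and>
                 mutual_information F P = informational_power P))"
proof -
  have E: "sic_ensemble (hesse (1 / 18))" and P: "sic_povm (hesse (1 / 6))"
    using hesse_sic[of "1 / 18"] hesse_sic[of "1 / 6"] by (simp_all add: sic_ensemble_def sic_povm_def)
  have "ereal (log 2 (3 / 2)) \<le> accessible_information (hesse (1 / 18))"
    unfolding accessible_information_def mutual_information_hesse_ensemble[symmetric]
    by (rule SUP_upper) (simp add: povm_standard)
  \<comment> \<open>For \<open>d = 3\<close> the general bound is \<open>log 2 (6 / 4)\<close>,
    which meets the value at the standard basis.\<close>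
  then have A: "accessible_information (hesse (1 / 18)) = ereal (log 2 (3 / 2))"
    using accessible_information_sic_ensemble_le[OF E] by simp
  have "ereal (log 2 (3 / 2)) \<le> informational_power (hesse (1 / 6))"
    unfolding informational_power_def mutual_information_hesse_povm[symmetric]
    by (rule SUP_upper) (simp add: ensemble_standard)
  then have W: "informational_power (hesse (1 / 6)) = ereal (log 2 (3 / 2))"
    using informational_power_sic_povm_le[OF P] by simp
  have "orthonormal_povm (standard 1)" "orthonormal_ensemble (standard (1 / 3))"
    using orthonormal_standard_basis
    by (auto simp: orthonormal_povm_def orthonormal_ensemble_def standard_def)
  then show ?thesis
    using E P A W povm_standard ensemble_standard mutual_information_hesse_ensemble mutual_information_hesse_povm
      accessible_information_sic_ensemble_le informational_power_sic_povm_le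
    by metis
qed

end
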